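(* Let $E$ be a real Hausdorff infrabarreled locally convex space and $\mathcal{K}\subset E$ a pointed cone. The following are equivalent. (i) $\mathcal{K}$ satisfies the weak property $(\pi)$. (ii) $0\in\mathrm{bPC}(\mathcal{K})$ and $\widehat{\mathcal{K}}$ is pointed.
   Context: $(E,\tau)$ is a real Hausdorff locally convex space with dual $E^*$. $E$ is infrabarreled if every barrel (closed, convex, balanced, absorbent set) in $E$ which absorbs all bounded sets is a neighbourhood of $0$. $\beta(E^*,E)$ is the topology on $E^*$ of uniform convergence on bounded subsets of $E$; $E^{**}$ is the dual of $(E^*,\beta(E^*,E))$; $\beta(E^{**},E^* )$ is the topology on $E^{**}$ of uniform convergence on $\beta(E^*,E)$-bounded subsets of $E^*$. $J_E:E\to E^{**}$ is the canonical map $J_E(x)(x^* )=x^*(x)$, and $\widehat{\mathcal{K}}$ is the $\beta(E^{**},E^* )$-closure of $J_E(\mathcal{K})$ in $E^{**}$. A cone $\mathcal{K}$ is a (nonempty) convex set with $\lambda k\in\mathcal{K}$ for all $\lambda\ge0$, $k\in\mathcal{K}$; it is pointed if $\mathcal{K}\cap(-\mathcal{K})=\{0\}$. $\mathcal{K}^*=\{x^*\in E^*: x^*(k)\ge0\ \forall k\in\mathcal{K}\}$. $\mathcal{K}$ satisfies the weak property $(\pi)$ if there exist $x^*\in\mathcal{K}^*$ and $\alpha>0$ such that $\mathcal{K}\cap\{x\in E:x^*(x)\le\alpha\}$ is bounded. $0\in\mathrm{bPC}(\mathcal{K})$ (bounded point of continuity) means: for every $\tau$-neighbourhood $U$ of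 $0$ there is a $\sigma(E,E^* )$-neighbourhood $W$ of $0$ with $W\cap\mathcal{K}\subset U$, and there is a $\sigma(E,E^* )$-neighbourhood $W$ of $0$ with $W\cap\mathcal{K}$ bounded. *)

theory Defs
  imports "HOL-Analysis.Analysis"
begin

section \<open>Real Hausdorff locally convex spaces\<close>

text \<open>Local convexity is required at the origin only, which suffices by translation. Convexity is
  spelled out because \<^const>\<open>convex\<close> cannot be used in the class specification; see
  \<open>convex_nbhd_at_0\<close> below.\<close>

class hausdorff_lcs = real_vector + topological_ab_group_add + t2_space +
  assumes tendsto_scaleR_Pair:
    "LIM x (nhds a \<times>\<^sub>F nhds b). fst x *\<^sub>R snd x :> nhds (a *\<^sub>R b)"
  and locally_convex_at_0:
    "open U \<Longrightarrow> 0 \<in> U \<Longrightarrow>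
      \<exists>V. (\<forall>x\<in>V. \<forall>y\<in>V. \<forall>u\<ge>0. \<forall>v\<ge>0. u + v = 1 \<longrightarrow> u *\<^sub>R x + v *\<^sub>R y \<in> V) \<and>
        V \<subseteq> U \<and> (\<exists>W. open W \<and> 0 \<in> W \<and> W \<subseteq> V)"

lemma convex_nbhd_at_0:
  fixes U :: "'a::hausdorff_lcs set"
  assumes "open U" "0 \<in> U"
  shows "\<exists>V. convex V \<and> V \<subseteq> U \<and> (\<exists>W. open W \<and> 0 \<in> W \<and> W \<subseteq> V)"
  using locally_convex_at_0[OF assms] unfolding convex_def .

definition nbhd_0 :: "'a::hausdorff_lcs set \<Rightarrow> bool" where
  "nbhd_0 U \<longleftrightarrow> (\<exists>V. open V \<and> 0 \<in> V \<and> V \<subseteq> U)"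

definition balanced :: "'a::real_vector set \<Rightarrow> bool" where
  "balanced A \<longleftrightarrow> (\<forall>c. \<bar>c\<bar> \<le> 1 \<longrightarrow> (*\<^sub>R) c ` A \<subseteq> A)"

definition absorbs :: "'a::real_vector set \<Rightarrow> 'a set \<Rightarrow> bool" where
  "absorbs A B \<longleftrightarrow> (\<exists>r>0. \<forall>t. r \<le> \<bar>t\<bar> \<longrightarrow> B \<subseteq> (*\<^sub>R) t ` A)"

definition absorbent :: "'a::real_vector set \<Rightarrow> bool" where
  "absorbent A \<longleftrightarrow> (\<forall>x. absorbs A {x})"

text \<open>Boundedness in the sense of topological vector spaces; the constant
  \<^const>\<open>bounded\<close> of the library is the metric notion.\<close>

definition tvs_bounded :: "'a::hausdorff_lcs set \<Rightarrow> bool" where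
  "tvs_bounded B \<longleftrightarrow> (\<forall>U. nbhd_0 U \<longrightarrow> absorbs U B)"

definition barrel :: "'a::hausdorff_lcs set \<Rightarrow> bool" where
  "barrel A \<longleftrightarrow> closed A \<and> convex A \<and> balanced A \<and> absorbent A"

definition infrabarreled :: "'a::hausdorff_lcs itself \<Rightarrow> bool" where
  "infrabarreled (_ :: 'a itself) \<longleftrightarrow>
     (\<forall>A :: 'a set. barrel A \<and> (\<forall>B. tvs_bounded B \<longrightarrow> absorbs A B) \<longrightarrow> nbhd_0 A)"

lemma tvs_bounded_subset: "tvs_bounded B \<Longrightarrow> A \<subseteq> B \<Longrightarrow> tvs_bounded A"
  unfolding tvs_bounded_def absorbs_def by (meson subset_trans)

lemma tvs_bounded_empty: "tvs_bounded {}"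
  unfolding tvs_bounded_def absorbs_def by (auto intro: exI[of _ 1])

lemma tvs_bounded_Un:
  fixes A B :: "'a::hausdorff_lcs set"
  assumes "tvs_bounded A" "tvs_bounded B"
  shows "tvs_bounded (A \<union> B)"
  unfolding tvs_bounded_def
proof (intro allI impI)
  fix U :: "'a set"
  assume U: "nbhd_0 U"
  have "absorbs U A" "absorbs U B"
    using assms U unfolding tvs_bounded_def by simp_all
  then obtain r s where r: "r > 0" "\<forall>t. r \<le> \<bar>t\<bar> \<longrightarrow> A \<subseteq> (*\<^sub>R) t ` U"
    and s: "s > 0" "\<forall>t. s \<le> \<bar>t\<bar> \<longrightarrow> B \<subseteq> (*\<^sub>R) t ` U"
    unfolding absorbs_def by (elim exE conjE)
  show "absorbs U (A \<union> B)"
    unfolding absorbs_def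
  proof (intro exI[of _ "max r s"] conjI allI impI)
    show "max r s > 0" using r by simp
    show "A \<union> B \<subseteq> (*\<^sub>R) t ` U" if "max r s \<le> \<bar>t\<bar>" for t
      using r(2) s(2) that by (intro Un_least) simp_all
  qed
qed

lemma tvs_bounded_singleton: "tvs_bounded {x::'a::hausdorff_lcs}"
  unfolding tvs_bounded_def
proof (intro allI impI)
  fix U :: "'a set"
  assume "nbhd_0 U"
  then obtain V where V: "open V" "0 \<in> V" "V \<subseteq> U"
    unfolding nbhd_0_def by blast
  have "LIM p (nhds 0 \<times>\<^sub>F nhds x). fst p *\<^sub>R snd p :> nhds (0 *\<^sub>R x)"
    by (rule tendsto_scaleR_Pair)
  then have "eventually (\<lambda>p. fst p *\<^sub>R snd p \<in> V) (nhds 0 \<times>\<^sub>F nhds x)"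
    using V by (simp add: tendsto_def)
  then obtain P Q where P: "eventually P (nhds (0::real))" and Q: "eventually Q (nhds x)"
    and PQ: "\<And>a y. P a \<Longrightarrow> Q y \<Longrightarrow> a *\<^sub>R y \<in> V"
    unfolding eventually_prod_filter by fastforce
  obtain d where d: "d > 0" "\<And>a. \<bar>a\<bar> < d \<Longrightarrow> P a"
    using P by (auto simp: eventually_nhds_metric)
  have Qx: "Q x" using Q by (rule eventually_nhds_x_imp_x)
  show "absorbs U {x}"
    unfolding absorbs_def
  proof (intro exI conjI allI impI)
    show "2 / d > 0" using d by simp
    fix t :: real
    assume t: "2 / d \<le> \<bar>t\<bar>"
    have td: "2 \<le> \<bar>t\<bar> * d" using t d(1) by (simp add: field_simps)
    then have t0: "t \<noteq> 0" by auto
    have "\<bar>inverse t\<bar> < d"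
      using t0 td by (simp add: abs_inverse field_simps)
    then have "inverse t *\<^sub>R x \<in> U" using PQ[OF d(2) Qx] V by blast
    then have "t *\<^sub>R (inverse t *\<^sub>R x) \<in> (*\<^sub>R) t ` U" by (rule imageI)
    then show "{x} \<subseteq> (*\<^sub>R) t ` U" using t0 by simp
  qed
qed


section \<open>The strong dual\<close>

typedef (overloaded) 'a dual = "{f :: 'a::hausdorff_lcs \<Rightarrow> real. linear f \<and> continuous_on UNIV f}"
  morphisms dual_apply Abs_dual
  by (rule exI[of _ "\<lambda>_. 0"]) (auto intro: linear_zero)

setup_lifting type_definition_dual

lemma linear_dual_apply: "linear (dual_apply f)"
  using dual_apply by blast

lemma continuous_on_dual_apply: "continuous_on UNIV (dual_apply f)"
  using dual_apply by blast

lemma dual_eqI: "(\<And>x. dual_apply f x = dual_apply g x) \<Longrightarrow> f = g"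
  by (metis dual_apply_inject ext)

lemma dual_apply_bounded_on:
  fixes f :: "'a::hausdorff_lcs dual"
  assumes "tvs_bounded B"
  obtains M where "M > 0" "\<And>x. x \<in> B \<Longrightarrow> \<bar>dual_apply f x\<bar> \<le> M"
proof -
  let ?U = "dual_apply f -` {-1<..<1}"
  have "open ?U"
    by (rule open_vimage[OF open_greaterThanLessThan continuous_on_dual_apply])
  moreover have "0 \<in> ?U"
    by (simp add: linear_0[OF linear_dual_apply])
  ultimately have "nbhd_0 ?U"
    unfolding nbhd_0_def by blast
  then have "absorbs ?U B"
    using assms unfolding tvs_bounded_def by simp
  then obtain r where r: "r > 0" "\<forall>t. r \<le> \<bar>t\<bar> \<longrightarrow> B \<subseteq> (*\<^sub>R) t ` ?U"
    unfolding absorbs_def by (elim exE conjE)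
  then have rB: "B \<subseteq> (*\<^sub>R) r ` ?U" by simp
  have "\<bar>dual_apply f x\<bar> \<le> r" if x: "x \<in> B" for x
  proof -
    obtain y where y: "x = r *\<^sub>R y" "\<bar>dual_apply f y\<bar> < 1"
      using rB x by force
    then show ?thesis
      using r(1) by (simp add: linear_scale[OF linear_dual_apply] abs_mult)
  qed
  with r(1) show thesis using that by blast
qed

instantiation dual :: (hausdorff_lcs) real_vector
begin

lift_definition zero_dual :: "'a dual" is "\<lambda>_. 0"
  by (auto intro: linear_zero)

lift_definition plus_dual :: "'a dual \<Rightarrow> 'a dual \<Rightarrow> 'a dual" is "\<lambda>f g x. f x + g x"
  by (auto intro: linear_compose_add continuous_intros)

lift_definition minus_dual :: "'a dual \<Rightarrow> 'a dual \<Rightarrow> 'a dual" is "\<lambda>f g x. f x - g x"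
  by (auto intro: linear_compose_sub continuous_intros)

lift_definition uminus_dual :: "'a dual \<Rightarrow> 'a dual" is "\<lambda>f x. - f x"
  by (auto intro: linear_compose_neg continuous_intros)

lift_definition scaleR_dual :: "real \<Rightarrow> 'a dual \<Rightarrow> 'a dual" is "\<lambda>c f x. c * f x"
  by (auto intro!: continuous_intros linearI simp: linear_add linear_scale algebra_simps)

instance
  by standard (transfer; simp add: algebra_simps)+

end

lemma dual_apply_simps [simp]:
  "dual_apply 0 x = 0"
  "dual_apply (f + g) x = dual_apply f x + dual_apply g x"
  "dual_apply (f - g) x = dual_apply f x - dual_apply g x"
  "dual_apply (- f) x = - dual_apply f x"
  "dual_apply (c *\<^sub>R f) x = c * dual_apply f x"
  by (transfer; simp)+

text \<open>The dual carries the topology of uniform convergence on bounded sets, so that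
  the type \<open>'a dual dual\<close> is the bidual with its own strong topology.\<close>

instantiation dual :: (hausdorff_lcs) topological_space
begin

definition open_dual :: "'a dual set \<Rightarrow> bool" where
  "open_dual S \<longleftrightarrow> (\<forall>f\<in>S. \<exists>B e. tvs_bounded B \<and> e > 0 \<and>
     {g. \<forall>x\<in>B. \<bar>dual_apply g x - dual_apply f x\<bar> < e} \<subseteq> S)"

instance
proof
  show "open (UNIV :: 'a dual set)"
    unfolding open_dual_def using tvs_bounded_empty zero_less_one by blast
next
  fix S T :: "'a dual set"
  assume ST: "open S" "open T"
  show "open (S \<inter> T)"
    unfolding open_dual_def
  proof
    fix f assume f: "f \<in> S \<inter> T"
    obtain B e where B: "tvs_bounded B" "e > 0"
      "{g. \<forall>x\<in>B. \<bar>dual_apply g x - dual_apply f x\<bar> < e} \<subseteq> S"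
      using ST f unfolding open_dual_def by blast
    obtain C d where C: "tvs_bounded C" "d > 0"
      "{g. \<forall>x\<in>C. \<bar>dual_apply g x - dual_apply f x\<bar> < d} \<subseteq> T"
      using ST f unfolding open_dual_def by blast
    have "{g. \<forall>x\<in>B \<union> C. \<bar>dual_apply g x - dual_apply f x\<bar> < min d e} \<subseteq> S \<inter> T"
      using B(3) C(3) by (simp add: subset_iff)
    moreover have "tvs_bounded (B \<union> C)" by (rule tvs_bounded_Un[OF B(1) C(1)])
    moreover have "min d e > 0" using B C by simp
    ultimately show "\<exists>B e. tvs_bounded B \<and> e > 0 \<and>
     {g. \<forall>x\<in>B. \<bar>dual_apply g x - dual_apply f x\<bar> < e} \<subseteq> S \<inter> T"
      by blast
  qed
next
  fix K :: "'a dual set set"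
  assume K: "\<forall>S\<in>K. open S"
  show "open (\<Union>K)"
    unfolding open_dual_def
  proof
    fix f assume "f \<in> \<Union>K"
    then obtain S where S: "S \<in> K" "f \<in> S" by blast
    then have "open S" using K by blast
    then obtain B e where B: "tvs_bounded B" "e > 0"
      "{g. \<forall>x\<in>B. \<bar>dual_apply g x - dual_apply f x\<bar> < e} \<subseteq> S"
      using S(2) unfolding open_dual_def by blast
    have "S \<subseteq> \<Union>K" using S(1) by blast
    with B show "\<exists>B e. tvs_bounded B \<and> e > 0 \<and>
     {g. \<forall>x\<in>B. \<bar>dual_apply g x - dual_apply f x\<bar> < e} \<subseteq> \<Union>K"
      by (meson subset_trans)
  qed
qed

end

lemma open_dual_basic:
  fixes f :: "'a::hausdorff_lcs dual"
  assumes "tvs_bounded B"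
  shows "open {g. \<exists>d<e. \<forall>x\<in>B. \<bar>dual_apply g x - dual_apply f x\<bar> \<le> d}" (is "open ?S")
  unfolding open_dual_def
proof
  fix g assume "g \<in> ?S"
  then obtain d where d: "d < e" "\<forall>x\<in>B. \<bar>dual_apply g x - dual_apply f x\<bar> \<le> d" by blast
  have "{h. \<forall>x\<in>B. \<bar>dual_apply h x - dual_apply g x\<bar> < (e - d) / 2} \<subseteq> ?S"
  proof
    fix h assume h: "h \<in> {h. \<forall>x\<in>B. \<bar>dual_apply h x - dual_apply g x\<bar> < (e - d) / 2}"
    have "\<bar>dual_apply h x - dual_apply f x\<bar> \<le> (e + d) / 2" if "x \<in> B" for x
    proof -
      have 1: "\<bar>dual_apply h x - dual_apply g x\<bar> < (e - d) / 2" using h that by blast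
      have 2: "\<bar>dual_apply g x - dual_apply f x\<bar> \<le> d" using d that by blast
      have 3: "(e - d) / 2 + d = (e + d) / 2" by (simp add: field_simps)
      show ?thesis using 1 2 3 by linarith
    qed
    moreover have "(e + d) / 2 < e" using d(1) by simp
    ultimately show "h \<in> ?S" by blast
  qed
  moreover have "(e - d) / 2 > 0" using d(1) by simp
  ultimately show "\<exists>C k. tvs_bounded C \<and> k > 0 \<and>
     {h. \<forall>x\<in>C. \<bar>dual_apply h x - dual_apply g x\<bar> < k} \<subseteq> ?S"
    using assms by blast
qed

lemma eventually_nhds_dual:
  fixes f :: "'a::hausdorff_lcs dual"
  shows "eventually P (nhds f) \<longleftrightarrow> (\<exists>B e. tvs_bounded B \<and> e > 0 \<and>
     (\<forall>g. (\<forall>x\<in>B. \<bar>dual_apply g x - dual_apply f x\<bar> < e) \<longrightarrow> P g))" (is "?L \<longleftrightarrow> ?R")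
proof
  assume ?L
  then obtain S where S: "open S" "f \<in> S" "\<forall>g\<in>S. P g"
    unfolding eventually_nhds by blast
  obtain B e where B: "tvs_bounded B" "e > 0"
    "{g. \<forall>x\<in>B. \<bar>dual_apply g x - dual_apply f x\<bar> < e} \<subseteq> S"
    using S(1,2) unfolding open_dual_def by blast
  have "\<forall>g. (\<forall>x\<in>B. \<bar>dual_apply g x - dual_apply f x\<bar> < e) \<longrightarrow> P g"
    using B(3) S(3) by blast
  with B(1,2) show ?R by blast
next
  assume ?R
  then obtain B e where B: "tvs_bounded B" "e > 0"
     "\<forall>g. (\<forall>x\<in>B. \<bar>dual_apply g x - dual_apply f x\<bar> < e) \<longrightarrow> P g"
    by (elim exE conjE)
  let ?S = "{g. \<exists>d<e. \<forall>x\<in>B. \<bar>dual_apply g x - dual_apply f x\<bar> \<le> d}"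
  have "open ?S" by (rule open_dual_basic[OF B(1)])
  moreover have "f \<in> ?S" using B(2) by (simp add: exI[of _ 0])
  moreover have "P g" if g: "g \<in> ?S" for g
  proof -
    obtain d where "d < e" "\<forall>x\<in>B. \<bar>dual_apply g x - dual_apply f x\<bar> \<le> d"
      using g by blast
    then have "\<forall>x\<in>B. \<bar>dual_apply g x - dual_apply f x\<bar> < e"
      using le_less_trans by blast
    then show ?thesis using B(3) by blast
  qed
  ultimately show ?L unfolding eventually_nhds by blast
qed

lemma eventually_dualI:
  fixes f :: "'a::hausdorff_lcs dual"
  assumes "tvs_bounded B" "e > 0"
  shows "eventually (\<lambda>g. \<forall>x\<in>B. \<bar>dual_apply g x - dual_apply f x\<bar> < e) (nhds f)"
  unfolding eventually_nhds_dual
  by (rule exI[of _ B], rule exI[of _ e]) (simp add: assms)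

lemma tendsto_dualI:
  fixes f :: "'a::hausdorff_lcs dual"
  assumes "\<And>B e. tvs_bounded B \<Longrightarrow> e > 0 \<Longrightarrow>
     eventually (\<lambda>y. \<forall>x\<in>B. \<bar>dual_apply (h y) x - dual_apply f x\<bar> < e) F"
  shows "(h \<longlongrightarrow> f) F"
  unfolding filterlim_iff
proof (intro allI impI)
  fix P assume "eventually P (nhds f)"
  then obtain B e where B: "tvs_bounded B" "e > 0"
   "\<forall>g. (\<forall>x\<in>B. \<bar>dual_apply g x - dual_apply f x\<bar> < e) \<longrightarrow> P g"
    unfolding eventually_nhds_dual by (elim exE conjE)
  show "eventually (\<lambda>y. P (h y)) F"
    using assms[OF B(1,2)] by (rule eventually_mono) (use B(3) in blast)
qed

instance dual :: (hausdorff_lcs) hausdorff_lcs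
proof
  fix f g :: "'a dual"
  show "LIM p (nhds f \<times>\<^sub>F nhds g). fst p + snd p :> nhds (f + g)"
  proof (rule tendsto_dualI)
    fix B :: "'a set" and e :: real
    assume B: "tvs_bounded B" "e > 0"
    have e: "e / 2 > 0" using B by simp
    show "\<forall>\<^sub>F p in nhds f \<times>\<^sub>F nhds g.
            \<forall>x\<in>B. \<bar>dual_apply (fst p + snd p) x - dual_apply (f + g) x\<bar> < e"
      using eventually_prodI[OF eventually_dualI[OF B(1) e, of f] eventually_dualI[OF B(1) e, of g]]
    proof (rule eventually_mono, intro ballI)
      fix p x
      assume *: "(\<forall>x\<in>B. \<bar>dual_apply (fst p) x - dual_apply f x\<bar> < e / 2) \<and>
        (\<forall>x\<in>B. \<bar>dual_apply (snd p) x - dual_apply g x\<bar> < e / 2)" and x: "x \<in> B"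
      have 1: "\<bar>dual_apply (fst p) x - dual_apply f x\<bar> < e / 2"
        and 2: "\<bar>dual_apply (snd p) x - dual_apply g x\<bar> < e / 2" using * x by blast+
      show "\<bar>dual_apply (fst p + snd p) x - dual_apply (f + g) x\<bar> < e"
        unfolding dual_apply_simps using 1 2 by linarith
    qed
  qed
next
  fix f :: "'a dual"
  show "(uminus \<longlongrightarrow> - f) (nhds f)"
  proof (rule tendsto_dualI)
    fix B :: "'a set" and e :: real
    assume B: "tvs_bounded B" "e > 0"
    show "\<forall>\<^sub>F y in nhds f. \<forall>x\<in>B. \<bar>dual_apply (- y) x - dual_apply (- f) x\<bar> < e"
      using eventually_dualI[OF B, of f] by (rule eventually_mono) (simp add: abs_minus_commute)
  qed
next
  fix f g :: "'a dual"
  assume "f \<noteq> g"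
  then obtain x where x: "dual_apply f x \<noteq> dual_apply g x"
    using dual_eqI by blast
  define e where "e = \<bar>dual_apply f x - dual_apply g x\<bar> / 2"
  have e: "e > 0" using x by (simp add: e_def)
  let ?U = "\<lambda>f. {g. \<exists>d<e. \<forall>y\<in>{x}. \<bar>dual_apply g y - dual_apply f y\<bar> \<le> d}"
  have "open (?U f)" "open (?U g)"
    by (rule open_dual_basic[OF tvs_bounded_singleton])+
  moreover have "f \<in> ?U f" "g \<in> ?U g" using e by (simp_all add: exI[of _ 0])
  moreover have "?U f \<inter> ?U g = {}"
  proof -
    have False if "d < e" "d' < e" "\<bar>dual_apply h x - dual_apply f x\<bar> \<le> d"
      "\<bar>dual_apply h x - dual_apply g x\<bar> \<le> d'" for h d d'
    proof -
      have "2 * e = \<bar>dual_apply f x - dual_apply g x\<bar>" by (simp add: e_def)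
      then show False using that by linarith
    qed
    then show ?thesis by blast
  qed
  ultimately show "\<exists>U V. open U \<and> open V \<and> f \<in> U \<and> g \<in> V \<and> U \<inter> V = {}"
    by blast
next
  fix a :: real and f :: "'a dual"
  show "LIM p (nhds a \<times>\<^sub>F nhds f). fst p *\<^sub>R snd p :> nhds (a *\<^sub>R f)"
  proof (rule tendsto_dualI)
    fix B :: "'a set" and e :: real
    assume B: "tvs_bounded B" "e > 0"
    obtain M where M: "M > 0" "\<And>x. x \<in> B \<Longrightarrow> \<bar>dual_apply f x\<bar> \<le> M"
      using dual_apply_bounded_on[OF B(1)] by blast
    define d where "d = min 1 (e / (2 * M))"
    define k where "k = e / (2 * (\<bar>a\<bar> + 1))"
    have d: "d > 0" using B M by (simp add: d_def)
    have k: "k > 0" using B by (simp add: k_def add_nonneg_pos)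
    have a: "eventually (\<lambda>b. \<bar>b - a\<bar> < d) (nhds a)"
      unfolding eventually_nhds_metric using d by (auto simp: dist_real_def)
    show "\<forall>\<^sub>F p in nhds a \<times>\<^sub>F nhds f.
            \<forall>x\<in>B. \<bar>dual_apply (fst p *\<^sub>R snd p) x - dual_apply (a *\<^sub>R f) x\<bar> < e"
      using eventually_prodI[OF a eventually_dualI[OF B(1) k, of f]]
    proof (rule eventually_mono, intro ballI)
      fix p x
      assume *: "\<bar>fst p - a\<bar> < d \<and> (\<forall>x\<in>B. \<bar>dual_apply (snd p) x - dual_apply f x\<bar> < k)"
        and x: "x \<in> B"
      define b u v where "b = fst p" and "u = dual_apply (snd p) x" and "v = dual_apply f x"
      have uv: "\<bar>u - v\<bar> < k" and vM: "\<bar>v\<bar> \<le> M" and ba: "\<bar>b - a\<bar> < d"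
        using * x M(2) unfolding u_def v_def b_def by blast+
      have "d \<le> 1" by (simp add: d_def)
      then have b1: "\<bar>b\<bar> \<le> \<bar>a\<bar> + 1" using ba by linarith
      have "b * u - a * v = b * (u - v) + (b - a) * v" by (simp add: algebra_simps)
      then have 1: "\<bar>b * u - a * v\<bar> \<le> \<bar>b\<bar> * \<bar>u - v\<bar> + \<bar>b - a\<bar> * \<bar>v\<bar>"
        by (metis abs_mult abs_triangle_ineq)
      have 2: "\<bar>b\<bar> * \<bar>u - v\<bar> \<le> (\<bar>a\<bar> + 1) * \<bar>u - v\<bar>"
        by (rule mult_right_mono[OF b1]) simp
      have 3: "(\<bar>a\<bar> + 1) * \<bar>u - v\<bar> < (\<bar>a\<bar> + 1) * k"
        by (rule mult_strict_left_mono[OF uv]) linarith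
      have "c * (e / (2 * c)) = e / 2" if "c \<noteq> 0" for c :: real
        using that by simp
      moreover have "\<bar>a\<bar> + 1 \<noteq> 0" by linarith
      ultimately have 4: "(\<bar>a\<bar> + 1) * k = e / 2"
        unfolding k_def by blast
      have 5: "\<bar>b - a\<bar> * \<bar>v\<bar> \<le> d * M"
        by (rule mult_mono) (use vM ba d in linarith)+
      have 6: "d * M \<le> (e / (2 * M)) * M"
        by (rule mult_right_mono) (use M in \<open>simp_all add: d_def\<close>)
      have 7: "(e / (2 * M)) * M = e / 2" using M by simp
      have "\<bar>b * u - a * v\<bar> < e" using 1 2 3 4 5 6 7 by linarith
      then show "\<bar>dual_apply (fst p *\<^sub>R snd p) x - dual_apply (a *\<^sub>R f) x\<bar> < e"
        by (simp add: b_def u_def v_def)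
    qed
  qed
next
  fix U :: "'a dual set"
  assume "open U" "0 \<in> U"
  then obtain B e where B: "tvs_bounded B" "e > 0"
    "{g. \<forall>x\<in>B. \<bar>dual_apply g x - dual_apply 0 x\<bar> < e} \<subseteq> U"
    unfolding open_dual_def by blast
  let ?V = "{g. \<forall>x\<in>B. \<bar>dual_apply g x - dual_apply 0 x\<bar> < e}"
  have "convex ?V"
  proof -
    have eq: "?V = (\<Inter>x\<in>B. (\<lambda>g. dual_apply g x) -` {-e<..<e})"
      by (auto simp: abs_less_iff minus_less_iff)
    have "convex ((\<lambda>g. dual_apply g x) -` {-e<..<e})" for x :: 'a
      by (rule convex_linear_vimage) (auto intro: linearI)
    then show ?thesis unfolding eq by (intro convex_INT)
  qed
  moreover have "\<exists>W. open W \<and> 0 \<in> W \<and> W \<subseteq> ?V"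
    using eventually_dualI[OF B(1,2), of 0] unfolding eventually_nhds by blast
  ultimately show "\<exists>V. (\<forall>x\<in>V. \<forall>y\<in>V. \<forall>u\<ge>0. \<forall>v\<ge>0. u + v = 1 \<longrightarrow> u *\<^sub>R x + v *\<^sub>R y \<in> V) \<and>
        V \<subseteq> U \<and> (\<exists>W. open W \<and> 0 \<in> W \<and> W \<subseteq> V)"
    using B(3) unfolding convex_def by blast
qed

lift_definition canonical_embedding :: "'a::hausdorff_lcs \<Rightarrow> 'a dual dual" is
  "\<lambda>x f. dual_apply f x"
proof
  fix x :: 'a
  show "linear (\<lambda>f. dual_apply f x)" by (auto intro: linearI)
  have "((\<lambda>f. dual_apply f x) \<longlongrightarrow> dual_apply f x) (at f)" for f
  proof (rule tendstoI)
    fix e :: real assume e: "e > 0"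
    show "eventually (\<lambda>g. dist (dual_apply g x) (dual_apply f x) < e) (at f)"
      unfolding eventually_at_filter
      using eventually_dualI[OF tvs_bounded_singleton[of x] e, of f]
      by (rule eventually_mono) (simp add: dist_real_def)
  qed
  then show "continuous_on UNIV (\<lambda>f. dual_apply f x)"
    by (simp add: continuous_on_def)
qed

definition weak_topology :: "'a::hausdorff_lcs topology" where
  "weak_topology = topology_generated_by {dual_apply f -` U | f U. open U}"

definition weak_nbhd_0 :: "'a::hausdorff_lcs set \<Rightarrow> bool" where
  "weak_nbhd_0 W \<longleftrightarrow> (\<exists>V. openin weak_topology V \<and> 0 \<in> V \<and> V \<subseteq> W)"


section \<open>Cones\<close>

text \<open>The cones considered are the sets satisfying \<^const>\<open>convex_cone\<close>: nonempty, convex and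
  closed under multiplication by nonnegative scalars.\<close>

definition pointed :: "'a::real_vector set \<Rightarrow> bool" where
  "pointed K \<longleftrightarrow> K \<inter> uminus ` K = {0}"

definition dual_cone :: "'a::hausdorff_lcs set \<Rightarrow> 'a dual set" where
  "dual_cone K = {f. \<forall>k\<in>K. dual_apply f k \<ge> 0}"

definition weak_property_pi :: "'a::hausdorff_lcs set \<Rightarrow> bool" where
  "weak_property_pi K \<longleftrightarrow>
     (\<exists>f\<in>dual_cone K. \<exists>\<alpha>>0. tvs_bounded (K \<inter> {x. dual_apply f x \<le> \<alpha>}))"

definition bidual_closure :: "'a::hausdorff_lcs set \<Rightarrow> 'a dual dual set" where
  "bidual_closure K = closure (canonical_embedding ` K)"

definition zero_in_bPC :: "'a::hausdorff_lcs set \<Rightarrow> bool" where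
  "zero_in_bPC K \<longleftrightarrow>
     (\<forall>U. nbhd_0 U \<longrightarrow> (\<exists>W. weak_nbhd_0 W \<and> W \<inter> K \<subseteq> U)) \<and>
     (\<exists>W. weak_nbhd_0 W \<and> tvs_bounded (W \<inter> K))"

end

theory Submission
  imports Defs
begin

text \<open>For the harder implication, take finitely many functionals \<open>F\<close> such that \<open>K \<inter> {p < \<epsilon>}\<close> is
  bounded, where \<open>p x = \<Sum>f\<in>F. \<bar>f x\<bar>\<close>. By homogeneity \<open>p\<close> controls every neighbourhood of 0 on \<open>K\<close>.
  Pointedness of the bidual closure then yields the normality estimate \<open>p a \<le> C * p (a + b)\<close> on \<open>K\<close>.
  This is a statement about the image of \<open>K\<close> in a finite-dimensional space, where a separation
  argument produces a linear combination of \<open>F\<close> that dominates a multiple of \<open>p\<close> on \<open>K\<close>.\<close>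

section \<open>Bounded sets and weak neighbourhoods of the origin\<close>

lemma tvs_bounded_scaleR:
  fixes B :: "'a::hausdorff_lcs set"
  assumes "tvs_bounded B" "c \<noteq> 0"
  shows "tvs_bounded ((*\<^sub>R) c ` B)"
  unfolding tvs_bounded_def
proof (intro allI impI)
  fix U :: "'a set"
  assume "nbhd_0 U"
  then obtain r where r: "r > 0" "\<And>t. r \<le> \<bar>t\<bar> \<Longrightarrow> B \<subseteq> (*\<^sub>R) t ` U"
    using assms(1) unfolding tvs_bounded_def absorbs_def by blast
  show "absorbs U ((*\<^sub>R) c ` B)"
    unfolding absorbs_def
  proof (intro exI conjI allI impI)
    show "r * \<bar>c\<bar> > 0" using r(1) assms(2) by simp
    fix t assume "r * \<bar>c\<bar> \<le> \<bar>t\<bar>"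
    then have "r \<le> \<bar>t / c\<bar>" using assms(2) by (simp add: field_simps)
    from r(2)[OF this] show "(*\<^sub>R) c ` B \<subseteq> (*\<^sub>R) t ` U"
      using assms(2) by (force simp: image_iff)
  qed
qed

text \<open>This form of absorption suits cones: a cone contains the positive multiples of its
  points, so membership of \<open>x\<close> in \<open>U\<close> reduces to placing one fixed
  multiple of \<open>x\<close> in \<open>B\<close>.\<close>

lemma nbhd_0_absorbs_scaled:
  assumes "tvs_bounded B" "nbhd_0 U"
  obtains r where "r > 0" "\<And>x. r *\<^sub>R x \<in> B \<Longrightarrow> x \<in> U"
proof -
  obtain r where r: "r > 0" "\<And>t. r \<le> \<bar>t\<bar> \<Longrightarrow> B \<subseteq> (*\<^sub>R) t ` U"
    using assms unfolding tvs_bounded_def absorbs_def by blast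
  have "x \<in> U" if "r *\<^sub>R x \<in> B" for x
  proof -
    have "r *\<^sub>R x \<in> (*\<^sub>R) r ` U" using r(2)[OF abs_ge_self] that by blast
    then obtain y where "r *\<^sub>R x = r *\<^sub>R y" "y \<in> U" by blast
    then show ?thesis using r(1) by simp
  qed
  with r(1) show thesis using that by blast
qed

lemma dual_apply_linear_simps [simp]:
  "dual_apply f 0 = 0"
  "dual_apply f (x + y) = dual_apply f x + dual_apply f y"
  "dual_apply f (x - y) = dual_apply f x - dual_apply f y"
  "dual_apply f (- x) = - dual_apply f x"
  "dual_apply f (c *\<^sub>R x) = c * dual_apply f x"
  using linear_dual_apply[of f]
  by (simp_all add: linear_0 linear_add linear_diff linear_neg linear_scale)

lemma dual_apply_sum: "dual_apply (\<Sum>i\<in>I. g i) x = (\<Sum>i\<in>I. dual_apply (g i) x)"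
  by (induction I rule: infinite_finite_induct) auto

lemma dual_apply_canonical_embedding [simp]: "dual_apply (canonical_embedding x) f = dual_apply f x"
  by transfer simp

text \<open>Enlarging \<open>F\<close> only increases the sum, so two such sets are intersected by
  uniting the families and taking the smaller radius. A single seminorm then stands for a whole weak
  neighbourhood.\<close>

lemma weak_nbhd_0_sum_abs:
  fixes W :: "'a::hausdorff_lcs set"
  assumes "weak_nbhd_0 W"
  obtains F e where "finite F" "e > 0" "{x. (\<Sum>f\<in>F. \<bar>dual_apply f x\<bar>) < e} \<subseteq> W"
proof -
  let ?S = "{dual_apply f -` U | (f :: 'a dual) U. open U}"
  have *: "0 \<in> V \<Longrightarrow> \<exists>F e. finite F \<and> e > 0 \<and> {x. (\<Sum>f\<in>F. \<bar>dual_apply f x\<bar>) < e} \<subseteq> V"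
    if "generate_topology_on ?S V" for V
    using that
  proof (induction rule: generate_topology_on.induct)
    case (Int A B)
    obtain F d where F: "finite F" "d > 0" "{x. (\<Sum>f\<in>F. \<bar>dual_apply f x\<bar>) < d} \<subseteq> A"
      using Int by blast
    obtain G e where G: "finite G" "e > 0" "{x. (\<Sum>f\<in>G. \<bar>dual_apply f x\<bar>) < e} \<subseteq> B"
      using Int by blast
    have "{x. (\<Sum>f\<in>F \<union> G. \<bar>dual_apply f x\<bar>) < min d e} \<subseteq> A \<inter> B"
    proof clarify
      fix x assume x: "(\<Sum>f\<in>F \<union> G. \<bar>dual_apply f x\<bar>) < min d e"
      have "(\<Sum>f\<in>F. \<bar>dual_apply f x\<bar>) \<le> (\<Sum>f\<in>F \<union> G. \<bar>dual_apply f x\<bar>)"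
        "(\<Sum>f\<in>G. \<bar>dual_apply f x\<bar>) \<le> (\<Sum>f\<in>F \<union> G. \<bar>dual_apply f x\<bar>)"
        using F G by (auto intro!: sum_mono2)
      then show "x \<in> A \<inter> B" using x F(3) G(3) by auto
    qed
    then show ?case using F(1,2) G(1,2)
      by (intro exI[of _ "F \<union> G"] exI[of _ "min d e"]) simp
  next
    case (UN \<K>)
    then obtain k where "k \<in> \<K>" "0 \<in> k" by blast
    with UN.IH show ?case by (meson Sup_upper subset_trans)
  next
    case (Basis s)
    then obtain f U where s: "s = dual_apply f -` U" "open U" "0 \<in> U" by auto
    then obtain e where "e > 0" "ball 0 e \<subseteq> U" by (meson openE)
    then show ?case using s
      by (intro exI[of _ "{f}"] exI[of _ e]) (auto simp: dist_real_def subset_iff)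
  qed simp
  show thesis
    using assms * that unfolding weak_nbhd_0_def weak_topology_def openin_topology_generated_by_iff
    by (meson subset_trans)
qed

lemma weak_nbhd_0_halfspace:
  assumes "\<alpha> > 0"
  shows "weak_nbhd_0 {x. dual_apply f x < \<alpha>}"
proof -
  have "openin weak_topology (dual_apply f -` {..<\<alpha>})"
    unfolding weak_topology_def
    by (rule topology_generated_by_Basis, intro CollectI exI[of _ f] exI[of _ "{..<\<alpha>}"]) simp
  then show ?thesis
    using assms unfolding weak_nbhd_0_def by (intro exI[of _ "dual_apply f -` {..<\<alpha>}"]) auto
qed

section \<open>Strongly bounded sets of functionals and limits in the bidual\<close>

text \<open>The set is a scaled polar of \<open>C\<close>, hence closed, convex and balanced. The
  strong neighbourhood given by a bounded set \<open>B\<close> absorbs \<open>C\<close>; bilinearity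
  of the pairing turns this around, so the polar absorbs \<open>B\<close>. Singletons
  \<open>B\<close> make it absorbent, and infrabarreledness applies.\<close>

lemma infrabarreled_polar_nbhd:
  fixes C :: "'a::hausdorff_lcs dual set"
  assumes "infrabarreled TYPE('a)" "tvs_bounded C" "e > 0"
  shows "nbhd_0 {x. \<forall>g\<in>C. \<bar>dual_apply g x\<bar> \<le> e}" (is "nbhd_0 ?A")
proof -
  have absorbs: "absorbs ?A B" if B: "tvs_bounded B" for B
  proof -
    have "nbhd_0 {g :: 'a dual. \<forall>x\<in>B. \<bar>dual_apply g x - dual_apply 0 x\<bar> < e}"
      using eventually_dualI[OF B assms(3), of 0] unfolding eventually_nhds nbhd_0_def by blast
    then obtain r where r: "r > 0"
      "\<And>t. r \<le> \<bar>t\<bar> \<Longrightarrow> C \<subseteq> (*\<^sub>R) t ` {g. \<forall>x\<in>B. \<bar>dual_apply g x - dual_apply 0 x\<bar> < e}"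
      using assms(2) unfolding tvs_bounded_def absorbs_def by blast
    have "B \<subseteq> (*\<^sub>R) t ` ?A" if t: "r \<le> \<bar>t\<bar>" for t
    proof
      fix x assume x: "x \<in> B"
      have t0: "t \<noteq> 0" using t r(1) by auto
      have "\<bar>dual_apply g (inverse t *\<^sub>R x)\<bar> \<le> e" if "g \<in> C" for g
      proof -
        obtain h where h: "g = t *\<^sub>R h" "\<forall>x\<in>B. \<bar>dual_apply h x - dual_apply 0 x\<bar> < e"
          using subsetD[OF r(2)[OF t] \<open>g \<in> C\<close>] by blast
        have "\<bar>dual_apply h x\<bar> < e" using bspec[OF h(2) x] by simp
        then show ?thesis using t0 by (simp add: h(1) flip: mult.assoc)
      qed
      then show "x \<in> (*\<^sub>R) t ` ?A" using t0 by (intro image_eqI[of _ _ "inverse t *\<^sub>R x"]) auto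
    qed
    then show ?thesis using r(1) unfolding absorbs_def by blast
  qed
  have eq: "?A = (\<Inter>g\<in>C. dual_apply g -` {-e..e})" by (auto simp: abs_le_iff minus_le_iff)
  have "closed ?A" unfolding eq
    by (intro closed_INT ballI closed_vimage continuous_on_dual_apply closed_atLeastAtMost)
  moreover have "convex ?A" unfolding eq
    by (intro convex_INT convex_linear_vimage linear_dual_apply convex_real_interval)
  moreover have "balanced ?A"
    unfolding balanced_def
  proof (intro allI impI subsetI)
    fix c :: real and y
    assume c: "\<bar>c\<bar> \<le> 1" and "y \<in> (*\<^sub>R) c ` ?A"
    then obtain x where x: "y = c *\<^sub>R x" "x \<in> ?A" by blast
    have "\<bar>c\<bar> * \<bar>dual_apply g x\<bar> \<le> 1 * e" if "g \<in> C" for g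
      using c x(2) that assms(3) by (intro mult_mono) auto
    then show "y \<in> ?A" using x by (simp add: abs_mult)
  qed
  moreover have "absorbent ?A"
    unfolding absorbent_def using absorbs tvs_bounded_singleton by blast
  ultimately show ?thesis
    using assms(1) absorbs unfolding infrabarreled_def barrel_def by blast
qed

text \<open>No completeness is needed here: the bidual is a strong dual, and a sequence bounded in
  \<open>E\<close> keeps the pointwise limit strongly continuous.\<close>

lemma canonical_embedding_Cauchy_limit:
  fixes X :: "nat \<Rightarrow> 'a::hausdorff_lcs"
  assumes bdd: "tvs_bounded (range X)"
    and Cauchy: "\<And>C e. tvs_bounded C \<Longrightarrow> e > 0 \<Longrightarrow>
      \<exists>N. \<forall>m\<ge>N. \<forall>n\<ge>N. \<forall>g\<in>C. \<bar>dual_apply g (X m) - dual_apply g (X n)\<bar> \<le> e"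
  obtains z where "(\<lambda>n. canonical_embedding (X n)) \<longlonglongrightarrow> z"
    "\<And>g. (\<lambda>n. dual_apply g (X n)) \<longlonglongrightarrow> dual_apply z g"
proof -
  have conv: "convergent (\<lambda>n. dual_apply g (X n))" for g
  proof (rule Cauchy_convergent, rule metric_CauchyI)
    fix e :: real assume "e > 0"
    then obtain N where
      "\<forall>m\<ge>N. \<forall>n\<ge>N. \<forall>g\<in>{g}. \<bar>dual_apply g (X m) - dual_apply g (X n)\<bar> \<le> e / 2"
      using Cauchy[OF tvs_bounded_singleton[of g], of "e / 2"] by auto
    then show "\<exists>N. \<forall>m\<ge>N. \<forall>n\<ge>N. dist (dual_apply g (X m)) (dual_apply g (X n)) < e"
      using \<open>e > 0\<close> by (intro exI[of _ N]) (fastforce simp: dist_real_def)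
  qed
  define L where "L g = lim (\<lambda>n. dual_apply g (X n))" for g
  have L: "(\<lambda>n. dual_apply g (X n)) \<longlonglongrightarrow> L g" for g
    using conv[of g] unfolding L_def by (simp add: convergent_LIMSEQ_iff)
  have "linear L"
  proof (rule linearI)
    fix g h :: "'a dual"
    show "L (g + h) = L g + L h"
      using LIMSEQ_unique[OF L[of "g + h"]] tendsto_add[OF L[of g] L[of h]] by simp
  next
    fix c and g :: "'a dual"
    show "L (c *\<^sub>R g) = c *\<^sub>R L g"
      using LIMSEQ_unique[OF L[of "c *\<^sub>R g"]] tendsto_mult_left[OF L[of g], of c] by simp
  qed
  moreover have "continuous_on UNIV L"
    unfolding continuous_on_def
  proof (intro ballI tendstoI)
    fix g :: "'a dual" and e :: real
    assume "e > 0"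
    then have "eventually (\<lambda>h. \<forall>x\<in>range X. \<bar>dual_apply h x - dual_apply g x\<bar> < e / 2) (nhds g)"
      by (intro eventually_dualI[OF bdd]) simp
    then have "eventually (\<lambda>h. dist (L h) (L g) < e) (nhds g)"
    proof (rule eventually_mono)
      fix h assume h: "\<forall>x\<in>range X. \<bar>dual_apply h x - dual_apply g x\<bar> < e / 2"
      have "\<bar>L h - L g\<bar> \<le> e / 2"
        using h by (intro tendsto_upperbound[OF tendsto_rabs[OF tendsto_diff[OF L[of h] L[of g]]]])
          (auto intro!: always_eventually less_imp_le)
      then show "dist (L h) (L g) < e" using \<open>e > 0\<close> by (simp add: dist_real_def)
    qed
    then show "eventually (\<lambda>h. dist (L h) (L g) < e) (at g within UNIV)"
      by (auto simp: eventually_at_filter elim: eventually_mono)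
  qed
  ultimately have z: "dual_apply (Abs_dual L) = L" by (simp add: Abs_dual_inverse)
  have "(\<lambda>n. canonical_embedding (X n)) \<longlonglongrightarrow> Abs_dual L"
  proof (rule tendsto_dualI)
    fix C :: "'a dual set" and e :: real
    assume C: "tvs_bounded C" "e > 0"
    then obtain N where N:
      "\<forall>m\<ge>N. \<forall>n\<ge>N. \<forall>g\<in>C. \<bar>dual_apply g (X m) - dual_apply g (X n)\<bar> \<le> e / 2"
      using Cauchy[OF C(1), of "e / 2"] by auto
    \<comment> \<open>Letting \<open>n\<close> tend to infinity at fixed \<open>m\<close> gives a
      bound uniform in \<open>g \<in> C\<close>, hence strong and not merely pointwise
      convergence.\<close>
    have "\<bar>dual_apply g (X m) - L g\<bar> < e" if "m \<ge> N" "g \<in> C" for m g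
    proof -
      have "\<bar>dual_apply g (X m) - L g\<bar> \<le> e / 2"
        using N that by (intro tendsto_upperbound[OF tendsto_rabs[OF tendsto_diff[OF tendsto_const L[of g]]]])
          (auto simp: eventually_sequentially)
      then show ?thesis using C(2) by simp
    qed
    then show "\<forall>\<^sub>F n in sequentially. \<forall>g\<in>C.
        \<bar>dual_apply (canonical_embedding (X n)) g - dual_apply (Abs_dual L) g\<bar> < e"
      by (auto simp: z eventually_sequentially)
  qed
  then show thesis using that L z by simp
qed

section \<open>Compactness and separation for finitely many functionals\<close>

text \<open>Bolzano-Weierstrass is applied to one index after another; sequences that already
  converge still do so along further subsequences.\<close>

lemma convergent_subsequence_finite_family:
  fixes s :: "'i \<Rightarrow> nat \<Rightarrow> real"
  assumes "finite I" "\<And>i. i \<in> I \<Longrightarrow> bounded (range (s i))"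
  shows "\<exists>r. strict_mono r \<and> (\<forall>i\<in>I. convergent (s i \<circ> r))"
  using assms
proof (induction I)
  case empty
  show ?case by (rule exI[of _ id]) (simp add: strict_mono_def)
next
  case (insert j I)
  then obtain r where r: "strict_mono r" "\<forall>i\<in>I. convergent (s i \<circ> r)" by blast
  have "bounded (range (s j \<circ> r))"
    using insert.prems by (auto intro: bounded_subset[of "range (s j)"])
  then obtain l q where q: "strict_mono q" "((s j \<circ> r) \<circ> q) \<longlonglongrightarrow> l"
    using bounded_imp_convergent_subsequence by blast
  have "convergent (s i \<circ> (r \<circ> q))" if "i \<in> I" for i
    using convergent_subseq_convergent[OF r(2)[rule_format, OF that] q(1)] by (simp add: o_assoc)
  moreover have "convergent (s j \<circ> (r \<circ> q))"
    using q(2) by (auto simp: convergent_def o_assoc)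
  ultimately have "\<forall>i\<in>insert j I. convergent (s i \<circ> (r \<circ> q))" by blast
  then show ?case
    by (intro exI[of _ "r \<circ> q"] conjI strict_mono_o[OF r(1) q(1)])
qed

text \<open>A point of \<open>D\<close> that almost minimises the Euclidean norm of \<open>(f i x)\<close> already defines a
  separating functional, so no closedness or compactness of \<open>D\<close> is required.\<close>

lemma separating_combination:
  fixes f :: "'i \<Rightarrow> 'a::real_vector \<Rightarrow> real"
  assumes lin: "\<And>i. i \<in> I \<Longrightarrow> linear (f i)" and D: "convex D" and "m > 0"
    and lower: "\<And>x. x \<in> D \<Longrightarrow> m \<le> (\<Sum>i\<in>I. (f i x)\<^sup>2)"
    and upper: "\<And>x. x \<in> D \<Longrightarrow> (\<Sum>i\<in>I. (f i x)\<^sup>2) \<le> M"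
  obtains c where "\<And>x. x \<in> D \<Longrightarrow> m / 2 \<le> (\<Sum>i\<in>I. c i * f i x)"
proof (cases "D = {}")
  case False
  define q where "q x = (\<Sum>i\<in>I. (f i x)\<^sup>2)" for x
  have bdd: "bdd_below (q ` D)" unfolding q_def using lower by (rule bdd_belowI2)
  have mM: "m \<le> M" using False lower upper by (meson all_not_in_conv order_trans)
  \<comment> \<open>The step size is chosen so that the total error \<open>t * (2 * m + M)\<close>
    in the variational inequality below is only \<open>m / 3\<close>. The tolerance
    \<open>t\<^sup>2 * m\<close> for the near-minimiser leaves \<open>t * m\<close> after division
    by \<open>t\<close>.\<close>
  define t where "t = m / (3 * (2 * m + M))"
  have den: "3 * (2 * m + M) > 0" using \<open>m > 0\<close> mM by simp
  have t: "0 < t" "t < 1" "t * (2 * m + M) = m / 3"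
    using den \<open>m > 0\<close> mM by (auto simp: t_def field_simps)
  have "Inf (q ` D) < Inf (q ` D) + t\<^sup>2 * m" using t \<open>m > 0\<close> by simp
  then obtain w where w: "w \<in> D" "q w < Inf (q ` D) + t\<^sup>2 * m"
    using False cInf_lessD[of "q ` D" "Inf (q ` D) + t\<^sup>2 * m"] by auto
  have "m / 2 \<le> (\<Sum>i\<in>I. f i w * f i x)" (is "_ \<le> ?P") if x: "x \<in> D" for x
  proof -
    \<comment> \<open>Moving from \<open>w\<close> towards \<open>x\<close> cannot lower
      \<open>q\<close> by more than the tolerance; expanding the square turns this into a lower
      bound for the inner product of \<open>w\<close> and \<open>x\<close>, with coefficients
      \<open>c i = f i w\<close>.\<close>
    let ?y = "(1 - t) *\<^sub>R w + t *\<^sub>R x"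
    have "?y \<in> D" using D w(1) x t by (auto intro!: convexD)
    then have y: "q w - t\<^sup>2 * m \<le> q ?y" using cInf_lower[OF _ bdd] w(2) by fastforce
    have "q ?y = (\<Sum>i\<in>I. (1 - t)\<^sup>2 * (f i w)\<^sup>2 + 2 * t * (1 - t) * (f i w * f i x) + t\<^sup>2 * (f i x)\<^sup>2)"
      unfolding q_def
    proof (rule sum.cong)
      fix i assume "i \<in> I"
      then have fy: "f i ?y = (1 - t) * f i w + t * f i x"
        using lin by (simp add: linear_add linear_scale)
      show "(f i ?y)\<^sup>2 =
          (1 - t)\<^sup>2 * (f i w)\<^sup>2 + 2 * t * (1 - t) * (f i w * f i x) + t\<^sup>2 * (f i x)\<^sup>2"
        unfolding fy by (simp add: power2_eq_square algebra_simps)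
    qed simp
    also have "\<dots> = (1 - t)\<^sup>2 * q w + 2 * t * (1 - t) * ?P + t\<^sup>2 * q x"
      by (simp add: q_def sum.distrib sum_distrib_left)
    also have "\<dots> = q w - t * ((2 - t) * q w - 2 * (1 - t) * ?P - t * q x)"
      by (simp add: power2_eq_square algebra_simps)
    finally have "t * ((2 - t) * q w - 2 * (1 - t) * ?P - t * q x) \<le> t * (t * m)"
      using y by (simp add: power2_eq_square)
    then have 1: "(2 - t) * q w - 2 * (1 - t) * ?P - t * q x \<le> t * m" using t(1) by simp
    have 2: "(2 - t) * m \<le> (2 - t) * q w" using t lower[OF w(1)] by (simp add: q_def)
    have 3: "t * q x \<le> t * M" using t upper[OF x] by (simp add: q_def)
    have "2 * m - t * (2 * m + M) \<le> 2 * ((1 - t) * ?P)" using 1 2 3 by (simp add: algebra_simps)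
    then have 4: "5 / 6 * m \<le> (1 - t) * ?P" using t(3) by simp
    then have "0 < (1 - t) * ?P" using \<open>m > 0\<close> by linarith
    then have "?P > 0" using t by (simp add: zero_less_mult_iff)
    then have "(1 - t) * ?P \<le> ?P" using t by simp
    then show ?thesis using 4 \<open>m > 0\<close> by linarith
  qed
  then show thesis by (rule that)
next
  case True
  then show thesis using that[of "\<lambda>_. 0"] by simp
qed

section \<open>Consequences of the weak property\<close>

text \<open>A half-space of the given functional already cuts off a bounded piece of
  \<open>K\<close>. By homogeneity of the cone, lowering its level from \<open>\<alpha>\<close> to
  \<open>\<alpha> / r\<close> shrinks the piece into any prescribed neighbourhood.\<close>

lemma weak_property_pi_imp_zero_in_bPC:
  assumes "convex_cone K" "weak_property_pi K"
  shows "zero_in_bPC K"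
proof -
  obtain f \<alpha> where f: "\<alpha> > 0" "tvs_bounded (K \<inter> {x. dual_apply f x \<le> \<alpha>})"
    using assms(2) unfolding weak_property_pi_def by blast
  show ?thesis
    unfolding zero_in_bPC_def
  proof (intro conjI allI impI)
    show "\<exists>W. weak_nbhd_0 W \<and> tvs_bounded (W \<inter> K)"
      using weak_nbhd_0_halfspace[OF f(1), of f] tvs_bounded_subset[OF f(2), of "{x. dual_apply f x < \<alpha>} \<inter> K"]
      by fastforce
  next
    fix U :: "'a set" assume "nbhd_0 U"
    then obtain r where r: "r > 0" "\<And>x. r *\<^sub>R x \<in> K \<inter> {x. dual_apply f x \<le> \<alpha>} \<Longrightarrow> x \<in> U"
      using nbhd_0_absorbs_scaled[OF f(2)] by blast
    have "{x. dual_apply f x < \<alpha> / r} \<inter> K \<subseteq> U"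
      using r f(1) by (auto intro!: r(2) convex_cone_scaleR[OF assms(1)] simp: field_simps)
    then show "\<exists>W. weak_nbhd_0 W \<and> W \<inter> K \<subseteq> U"
      using weak_nbhd_0_halfspace[of "\<alpha> / r" f] f(1) r(1) by auto
  qed
qed

text \<open>If \<open>f\<close> has bounded sublevel sets on \<open>K\<close>, every \<open>g\<close> satisfies \<open>\<bar>g\<bar> \<le> C f\<close> on \<open>K\<close>; this passes
  to the closure in the bidual.\<close>

lemma weak_property_pi_imp_pointed_bidual_closure:
  fixes K :: "'a::hausdorff_lcs set"
  assumes "convex_cone K" "weak_property_pi K"
  shows "pointed (bidual_closure K)"
proof -
  obtain f \<alpha> where f: "f \<in> dual_cone K" "\<alpha> > 0" "tvs_bounded (K \<inter> {x. dual_apply f x \<le> \<alpha>})"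
    using assms(2) unfolding weak_property_pi_def by blast
  have bound: "\<exists>C. \<forall>z\<in>bidual_closure K. \<bar>dual_apply z g\<bar> \<le> C * dual_apply z f" for g
  proof -
    obtain M where M: "M > 0" "\<And>x. x \<in> K \<inter> {x. dual_apply f x \<le> \<alpha>} \<Longrightarrow> \<bar>dual_apply g x\<bar> \<le> M"
      using dual_apply_bounded_on[OF f(3)] by blast
    have K: "\<bar>dual_apply g k\<bar> \<le> M / \<alpha> * dual_apply f k" if k: "k \<in> K" for k
    proof (rule field_le_epsilon)
      fix e :: real assume "e > 0"
      \<comment> \<open>The extra term keeps \<open>s\<close> positive when \<open>f\<close>
        vanishes at \<open>k\<close>, and contributes exactly \<open>e\<close> after multiplication
        by \<open>M / \<alpha>\<close>.\<close>
      define s where "s = dual_apply f k + e * \<alpha> / M"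
      have fk: "dual_apply f k \<ge> 0" using f(1) k unfolding dual_cone_def by blast
      have s: "s > 0" "dual_apply f k \<le> s" using fk \<open>e > 0\<close> f(2) M(1) by (auto simp: s_def intro: add_nonneg_pos)
      have "(\<alpha> / s) *\<^sub>R k \<in> K \<inter> {x. dual_apply f x \<le> \<alpha>}"
        using s f(2) k by (auto intro!: convex_cone_scaleR[OF assms(1)] simp: field_simps)
      from M(2)[OF this] have "\<alpha> / s * \<bar>dual_apply g k\<bar> \<le> M"
        using f(2) s by (simp add: abs_mult)
      then have "\<bar>dual_apply g k\<bar> \<le> M / \<alpha> * s" using s f(2) by (simp add: field_simps)
      also have "\<dots> = M / \<alpha> * dual_apply f k + e" using f(2) M(1) by (simp add: s_def field_simps)
      finally show "\<bar>dual_apply g k\<bar> \<le> M / \<alpha> * dual_apply f k + e" .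
    qed
    have "closed {z :: 'a dual dual. \<bar>dual_apply z g\<bar> \<le> M / \<alpha> * dual_apply z f}"
    proof -
      \<comment> \<open>\<open>canonical_embedding\<close> is used here one level up, on the dual:
        evaluation at \<open>h\<close> is a continuous functional on the bidual.\<close>
      have cont: "continuous_on UNIV (\<lambda>z :: 'a dual dual. dual_apply z h)" for h
        using continuous_on_dual_apply[of "canonical_embedding h"] by simp
      show ?thesis by (intro closed_Collect_le continuous_intros cont)
    qed
    then have "bidual_closure K \<subseteq> {z. \<bar>dual_apply z g\<bar> \<le> M / \<alpha> * dual_apply z f}"
      unfolding bidual_closure_def using K by (intro closure_minimal) auto
    then show ?thesis by blast
  qed
  have "z = 0" if z: "z \<in> bidual_closure K" "- z \<in> bidual_closure K" for z
  proof -
    have f0: "dual_apply z f = 0"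
    proof -
      \<comment> \<open>Used at both \<open>z\<close> and \<open>- z\<close>, the estimate bounds
        \<open>\<bar>dual_apply z f\<bar>\<close> by a number and by its negative.\<close>
      obtain C where C: "\<forall>z\<in>bidual_closure K. \<bar>dual_apply z (- f)\<bar> \<le> C * dual_apply z f"
        using bound by blast
      have "\<bar>dual_apply z f\<bar> \<le> C * dual_apply z f" "\<bar>dual_apply z f\<bar> \<le> - (C * dual_apply z f)"
        using C[rule_format, OF z(1)] C[rule_format, OF z(2)] by auto
      then show ?thesis by linarith
    qed
    have "dual_apply z g = 0" for g using bound[of g] z(1) f0 by fastforce
    then show ?thesis by (intro dual_eqI) simp
  qed
  moreover have "0 \<in> bidual_closure K"
  proof -
    have "canonical_embedding (0::'a) = 0" by (intro dual_eqI) simp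
    then show ?thesis
      using convex_cone_contains_0[OF assms(1)] closure_subset unfolding bidual_closure_def
      by (metis image_eqI subsetD)
  qed
  ultimately show ?thesis unfolding pointed_def by (force simp: image_iff)
qed

section \<open>Normality of the cone from pointedness of the bidual closure\<close>

text \<open>Failure of the estimate would give \<open>a\<^sub>n, b\<^sub>n \<in> K\<close> with \<open>\<Sum>\<bar>f a\<^sub>n\<bar> = 1\<close>, all \<open>f a\<^sub>n\<close>
  convergent and all \<open>f (a\<^sub>n + b\<^sub>n)\<close> tending to 0. Then \<open>a\<^sub>m + b\<^sub>n \<rightarrow> 0\<close> jointly in \<open>m\<close> and \<open>n\<close>,
  which makes both sequences Cauchy; their limits in the bidual are nonzero and opposite.\<close>

lemma normal_of_pointed_bidual_closure:
  fixes K :: "'a::hausdorff_lcs set" and F :: "'a dual set"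
  defines "p \<equiv> \<lambda>x. \<Sum>f\<in>F. \<bar>dual_apply f x\<bar>"
  assumes ib: "infrabarreled TYPE('a)" and K: "convex_cone K"
    and F: "finite F" and "\<epsilon> > 0" and bdd: "tvs_bounded (K \<inter> {x. p x < \<epsilon>})"
    and pt: "pointed (bidual_closure K)"
  obtains C where "C > 0" "\<And>a b. a \<in> K \<Longrightarrow> b \<in> K \<Longrightarrow> p a \<le> C * p (a + b)"
proof (rule ccontr)
  assume no: "\<not> thesis"
  have p_scale: "p (c *\<^sub>R x) = \<bar>c\<bar> * p x" for c x
    by (simp add: p_def abs_mult sum_distrib_left)
  have p_nonneg: "p x \<ge> 0" for x by (simp add: p_def sum_nonneg)
  have "\<exists>a\<in>K. \<exists>b\<in>K. p a = 1 \<and> p (a + b) \<le> inverse (real (Suc n))" for n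
  proof -
    \<comment> \<open>Failure with constant \<open>Suc n\<close> forces \<open>p a > 0\<close>, so
      the pair can be rescaled to \<open>p a = 1\<close>.\<close>
    have "\<exists>a\<in>K. \<exists>b\<in>K. \<not> p a \<le> real (Suc n) * p (a + b)"
      using no that[of "real (Suc n)"] by (meson of_nat_0_less_iff zero_less_Suc)
    then obtain a b where ab: "a \<in> K" "b \<in> K" "real (Suc n) * p (a + b) < p a"
      by (auto simp: not_le)
    have "real (Suc n) * p (a + b) \<ge> 0" using p_nonneg by simp
    then have pa: "p a > 0" using ab(3) by linarith
    let ?c = "inverse (p a)"
    have "p (?c *\<^sub>R a + ?c *\<^sub>R b) = ?c * p (a + b)"
      using pa p_scale[of ?c "a + b"] by (simp add: scaleR_add_right)
    also have "\<dots> \<le> inverse (real (Suc n))" using ab(3) pa by (simp add: field_simps)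
    finally show ?thesis using ab pa
      by (intro bexI[of _ "?c *\<^sub>R a"] bexI[of _ "?c *\<^sub>R b"])
        (auto simp: p_scale intro!: convex_cone_scaleR[OF K])
  qed
  then obtain a b where ab: "\<And>n. a n \<in> K" "\<And>n. b n \<in> K" "\<And>n. p (a n) = 1"
    "\<And>n. p (a n + b n) \<le> inverse (real (Suc n))" by metis
  have f_le_p: "\<bar>dual_apply f x\<bar> \<le> p x" if "f \<in> F" for f x
    unfolding p_def using F that by (intro member_le_sum) auto
  have "bounded (range (\<lambda>n. dual_apply f (a n)))" if "f \<in> F" for f
    using f_le_p[OF that, of "a _"] ab(3) by (auto simp: bounded_iff)
  then obtain r where r: "strict_mono r"
    "\<And>f. f \<in> F \<Longrightarrow> convergent ((\<lambda>n. dual_apply f (a n)) \<circ> r)"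
    using convergent_subsequence_finite_family[OF F, of "\<lambda>f n. dual_apply f (a n)"] by blast
  obtain u where u: "\<And>f. f \<in> F \<Longrightarrow> (\<lambda>n. dual_apply f (a (r n))) \<longlonglongrightarrow> u f"
    using r(2) unfolding convergent_def o_def by metis
  define X Y where "X n = a (r n)" and "Y n = b (r n)" for n
  have XK: "X n \<in> K" and YK: "Y n \<in> K" and pX: "p (X n) = 1" for n
    using ab by (auto simp: X_def Y_def)
  have fX: "(\<lambda>n. dual_apply f (X n)) \<longlonglongrightarrow> u f" if "f \<in> F" for f
    using u[OF that] by (simp add: X_def)
  have pXY: "p (X n + Y n) \<le> inverse (real (Suc n))" for n
    unfolding X_def Y_def using ab(4)[of "r n"] seq_suble[OF r(1), of n]
    by (smt (verit) inverse_le_iff_le of_nat_0_less_iff of_nat_le_iff Suc_le_mono zero_less_Suc)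
  have fXY: "(\<lambda>n. dual_apply f (X n + Y n)) \<longlonglongrightarrow> 0" if "f \<in> F" for f
    using order_trans[OF f_le_p[OF that] pXY]
    by (intro Lim_null_comparison[OF _ LIMSEQ_inverse_real_of_nat]) (auto intro: always_eventually)
  have pY: "p (Y n) \<le> 2" for n
  proof -
    have "p (Y n) \<le> (\<Sum>f\<in>F. \<bar>dual_apply f (X n + Y n)\<bar> + \<bar>dual_apply f (X n)\<bar>)"
      unfolding p_def by (intro sum_mono) simp
    also have "\<dots> = p (X n + Y n) + p (X n)" by (simp add: p_def sum.distrib)
    also have "\<dots> \<le> 2" using pXY[of n] pX[of n] inverse_le_1_iff[of "real (Suc n)"] by simp
    finally show ?thesis .
  qed
  have bounded: "tvs_bounded (range Z)" if Z: "\<And>n. Z n \<in> K" "\<And>n. p (Z n) \<le> 2" for Z :: "nat \<Rightarrow> 'a"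
  proof (rule tvs_bounded_subset[OF tvs_bounded_scaleR[OF bdd, of "4 / \<epsilon>"]])
    \<comment> \<open>The factor \<open>\<epsilon> / 4\<close> turns the bound 2 into
      \<open>\<epsilon> / 2\<close>, which meets the strict inequality of the sublevel set.\<close>
    have "(\<epsilon> / 4) *\<^sub>R Z n \<in> K \<inter> {x. p x < \<epsilon>}" for n
    proof -
      have "\<epsilon> / 4 * p (Z n) \<le> \<epsilon> / 4 * 2" using Z(2)[of n] \<open>\<epsilon> > 0\<close> by (intro mult_left_mono) auto
      then show ?thesis using \<open>\<epsilon> > 0\<close> Z(1) by (auto simp: p_scale intro: convex_cone_scaleR[OF K])
    qed
    then show "range Z \<subseteq> (*\<^sub>R) (4 / \<epsilon>) ` (K \<inter> {x. p x < \<epsilon>})"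
      using \<open>\<epsilon> > 0\<close> by (auto intro!: image_eqI[of "Z _" _ "(\<epsilon> / 4) *\<^sub>R Z _"])
  qed (use \<open>\<epsilon> > 0\<close> in simp)
  have joint: "\<exists>N. \<forall>m\<ge>N. \<forall>n\<ge>N. p (X m + Y n) < d" if "d > 0" for d
  proof -
    \<comment> \<open>Both \<open>f (X n) - u f\<close> and \<open>u f + f (Y n)\<close> tend to 0.
      Passing through \<open>u f\<close> separates the indices, so \<open>p (X m + Y n)\<close> is
      at most the displayed sum at \<open>m\<close> plus the same sum at \<open>n\<close>.\<close>
    have "(\<lambda>n. \<Sum>f\<in>F. \<bar>dual_apply f (X n) - u f\<bar> + \<bar>u f + dual_apply f (Y n)\<bar>) \<longlonglongrightarrow> (\<Sum>f\<in>F. \<bar>u f - u f\<bar> + \<bar>u f + (0 - u f)\<bar>)"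
    proof (intro tendsto_intros fX)
      fix f assume "f \<in> F"
      from tendsto_diff[OF fXY fX, OF this this]
      show "(\<lambda>n. dual_apply f (Y n)) \<longlonglongrightarrow> 0 - u f" by simp
    qed
    then have "eventually (\<lambda>n. (\<Sum>f\<in>F. \<bar>dual_apply f (X n) - u f\<bar> + \<bar>u f + dual_apply f (Y n)\<bar>) < d / 2) sequentially"
      using that by (intro order_tendstoD(2)) auto
    then obtain N where N: "\<And>n. n \<ge> N \<Longrightarrow>
        (\<Sum>f\<in>F. \<bar>dual_apply f (X n) - u f\<bar> + \<bar>u f + dual_apply f (Y n)\<bar>) < d / 2"
      by (auto simp: eventually_sequentially)
    have "p (X m + Y n) < d" if "m \<ge> N" "n \<ge> N" for m n
    proof -
      have "p (X m + Y n) \<le> (\<Sum>f\<in>F. (\<bar>dual_apply f (X m) - u f\<bar> + \<bar>u f + dual_apply f (Y m)\<bar>) +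
          (\<bar>dual_apply f (X n) - u f\<bar> + \<bar>u f + dual_apply f (Y n)\<bar>))"
        unfolding p_def by (intro sum_mono) simp
      also have "\<dots> < d" using N[OF that(1)] N[OF that(2)] by (simp add: sum.distrib)
      finally show ?thesis .
    qed
    then show ?thesis by blast
  qed
  have small: "\<exists>N. \<forall>m\<ge>N. \<forall>n\<ge>N. \<forall>g\<in>C. \<bar>dual_apply g (X m) + dual_apply g (Y n)\<bar> \<le> e / 2"
    if C: "tvs_bounded C" "e > 0" for C :: "'a dual set" and e
  proof -
    have nb: "nbhd_0 {x. \<forall>g\<in>C. \<bar>dual_apply g x\<bar> \<le> e / 2}"
      by (rule infrabarreled_polar_nbhd[OF ib C(1)]) (use C(2) in simp)
    obtain t where t: "t > 0"
      "\<And>x. t *\<^sub>R x \<in> K \<inter> {x. p x < \<epsilon>} \<Longrightarrow> x \<in> {x. \<forall>g\<in>C. \<bar>dual_apply g x\<bar> \<le> e / 2}"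
      using nbhd_0_absorbs_scaled[OF bdd nb] by blast
    obtain N where N: "\<And>m n. m \<ge> N \<Longrightarrow> n \<ge> N \<Longrightarrow> p (X m + Y n) < \<epsilon> / t"
      using joint[of "\<epsilon> / t"] \<open>\<epsilon> > 0\<close> t(1) by auto
    \<comment> \<open>Sums stay in \<open>K\<close>, where smallness of \<open>p\<close> forces
      membership in a given neighbourhood; differences of points of \<open>K\<close> need not stay
      there.\<close>
    have "X m + Y n \<in> {x. \<forall>g\<in>C. \<bar>dual_apply g x\<bar> \<le> e / 2}" if "m \<ge> N" "n \<ge> N" for m n
    proof (rule t(2), intro IntI CollectI)
      show "t *\<^sub>R (X m + Y n) \<in> K"
        using t(1) XK YK by (intro convex_cone_scaleR[OF K] convex_cone_add[OF K]) auto
      show "p (t *\<^sub>R (X m + Y n)) < \<epsilon>"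
        using N[OF that] t(1) unfolding p_scale abs_of_pos[OF t(1)]
        by (simp add: pos_less_divide_eq mult.commute)
    qed
    then show ?thesis by (intro exI[of _ N]) auto
  qed
  obtain x where x: "(\<lambda>n. canonical_embedding (X n)) \<longlonglongrightarrow> x"
    "\<And>g. (\<lambda>n. dual_apply g (X n)) \<longlonglongrightarrow> dual_apply x g"
  proof (rule canonical_embedding_Cauchy_limit)
    show "tvs_bounded (range X)" using bounded XK pX by simp
    fix C :: "'a dual set" and e :: real
    assume "tvs_bounded C" "e > 0"
    from small[OF this] obtain N where N: "\<And>m n g. m \<ge> N \<Longrightarrow> n \<ge> N \<Longrightarrow> g \<in> C \<Longrightarrow>
        \<bar>dual_apply g (X m) + dual_apply g (Y n)\<bar> \<le> e / 2" by blast
    \<comment> \<open>\<open>X m - X n\<close> is the difference of the small vectors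
      \<open>X m + Y N\<close> and \<open>X n + Y N\<close>.\<close>
    have "\<bar>dual_apply g (X m) - dual_apply g (X n)\<bar> \<le> e" if "m \<ge> N" "n \<ge> N" "g \<in> C" for m n g
      using N[of m N g] N[of n N g] that by linarith
    then show "\<exists>N. \<forall>m\<ge>N. \<forall>n\<ge>N. \<forall>g\<in>C. \<bar>dual_apply g (X m) - dual_apply g (X n)\<bar> \<le> e" by blast
  qed (use that in blast)
  obtain y where y: "(\<lambda>n. canonical_embedding (Y n)) \<longlonglongrightarrow> y"
    "\<And>g. (\<lambda>n. dual_apply g (Y n)) \<longlonglongrightarrow> dual_apply y g"
  proof (rule canonical_embedding_Cauchy_limit)
    show "tvs_bounded (range Y)" using bounded YK pY by simp
    fix C :: "'a dual set" and e :: real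
    assume "tvs_bounded C" "e > 0"
    from small[OF this] obtain N where N: "\<And>m n g. m \<ge> N \<Longrightarrow> n \<ge> N \<Longrightarrow> g \<in> C \<Longrightarrow>
        \<bar>dual_apply g (X m) + dual_apply g (Y n)\<bar> \<le> e / 2" by blast
    have "\<bar>dual_apply g (Y m) - dual_apply g (Y n)\<bar> \<le> e" if "m \<ge> N" "n \<ge> N" "g \<in> C" for m n g
      using N[of N m g] N[of N n g] that by linarith
    then show "\<exists>N. \<forall>m\<ge>N. \<forall>n\<ge>N. \<forall>g\<in>C. \<bar>dual_apply g (Y m) - dual_apply g (Y n)\<bar> \<le> e" by blast
  qed (use that in blast)
  have "dual_apply x g + dual_apply y g = 0" for g
  proof -
    have "\<bar>dual_apply x g + dual_apply y g\<bar> \<le> 0 + e" if "e > 0" for e :: real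
    proof -
      from small[OF tvs_bounded_singleton[of g] that] obtain N where
        "\<And>n. n \<ge> N \<Longrightarrow> \<bar>dual_apply g (X n) + dual_apply g (Y n)\<bar> \<le> e / 2" by blast
      then have "\<bar>dual_apply x g + dual_apply y g\<bar> \<le> e / 2"
        by (intro tendsto_upperbound[OF tendsto_rabs[OF tendsto_add[OF x(2)[of g] y(2)[of g]]]])
          (auto simp: eventually_sequentially)
      then show ?thesis using that by simp
    qed
    then show ?thesis using field_le_epsilon[of "\<bar>dual_apply x g + dual_apply y g\<bar>" 0] by simp
  qed
  then have "y = - x" by (intro dual_eqI) (simp add: eq_neg_iff_add_eq_0 add.commute)
  moreover have "w \<in> bidual_closure K"
    if "\<And>n. Z n \<in> K" "(\<lambda>n. canonical_embedding (Z n)) \<longlonglongrightarrow> w" for Z :: "nat \<Rightarrow> 'a" and w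
    unfolding bidual_closure_def
    by (rule Lim_in_closed_set[OF closed_closure _ _ that(2)])
      (auto intro!: always_eventually subsetD[OF closure_subset] that(1))
  then have "x \<in> bidual_closure K" "y \<in> bidual_closure K" using XK YK x(1) y(1) by blast+
  ultimately have "x \<in> bidual_closure K \<inter> uminus ` bidual_closure K"
    by (auto simp: image_iff intro!: bexI[of _ "- x"])
  then have "x = 0" using pt unfolding pointed_def by simp
  \<comment> \<open>Since \<open>F\<close> is finite, the normalisation \<open>p (X n) = 1\<close>
    passes to the limit and contradicts \<open>x = 0\<close>.\<close>
  moreover have "(\<lambda>n. p (X n)) \<longlonglongrightarrow> (\<Sum>f\<in>F. \<bar>dual_apply x f\<bar>)"
    unfolding p_def by (intro tendsto_intros x(2))
  ultimately have "(\<lambda>n. 1::real) \<longlonglongrightarrow> 0" by (simp add: pX)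
  then show False by (simp add: LIMSEQ_const_iff)
qed

section \<open>A single functional dominating the seminorm\<close>

text \<open>The set \<open>D\<close> replaces the convex hull of \<open>{k \<in> K. p k = 1}\<close>, which it contains: splitting a
  vector of the hull according to the sign of each \<open>f\<close> gives the two summands \<open>a f\<close> and \<open>b f\<close>, and
  normality keeps such a vector away from the common kernel of \<open>F\<close>.\<close>

lemma normal_imp_dominating_functional:
  fixes K :: "'a::hausdorff_lcs set" and F :: "'a dual set"
  defines "p \<equiv> \<lambda>x. \<Sum>f\<in>F. \<bar>dual_apply f x\<bar>"
  assumes K: "convex_cone K" and F: "finite F" and "C > 0"
    and normal: "\<And>a b. a \<in> K \<Longrightarrow> b \<in> K \<Longrightarrow> p a \<le> C * p (a + b)"
  obtains \<phi> \<delta> where "\<delta> > 0" "\<And>k. k \<in> K \<Longrightarrow> \<delta> * p k \<le> dual_apply \<phi> k"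
proof -
  have p_scale: "p (c *\<^sub>R x) = \<bar>c\<bar> * p x" for c x
    by (simp add: p_def abs_mult sum_distrib_left)
  have p_nonneg: "p x \<ge> 0" for x by (simp add: p_def sum_nonneg)
  have f_le_p: "\<bar>dual_apply f x\<bar> \<le> p x" if "f \<in> F" for f x
    unfolding p_def using F that by (intro member_le_sum) auto
  \<comment> \<open>The absolute values in \<open>p x = 1\<close> are traded for a normalisation
    linear in \<open>a\<close> and \<open>b\<close>, so splittings of two vectors combine into a
    splitting of any convex combination.\<close>
  define split where "split x a b \<longleftrightarrow> (\<forall>f\<in>F. a f \<in> K \<and> b f \<in> K \<and> x = a f + b f) \<and>
    (\<Sum>f\<in>F. dual_apply f (a f) - dual_apply f (b f)) = 1" for x a b
  define D where "D = {x. p x \<le> 1 \<and> (\<exists>a b. split x a b)}"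
  define N where "N = real (card F)"
  have "convex D"
  proof (rule convexI)
    fix x y and s t :: real
    assume xy: "x \<in> D" "y \<in> D" and st: "0 \<le> s" "0 \<le> t" "s + t = 1"
    obtain a b where ab: "split x a b" using xy unfolding D_def by blast
    obtain c d where cd: "split y c d" using xy unfolding D_def by blast
    have "p (s *\<^sub>R x + t *\<^sub>R y) \<le> (\<Sum>f\<in>F. \<bar>dual_apply f (s *\<^sub>R x)\<bar> + \<bar>dual_apply f (t *\<^sub>R y)\<bar>)"
      unfolding p_def by (intro sum_mono) simp
    also have "\<dots> = s * p x + t * p y"
      using st p_scale[of s x] p_scale[of t y] by (simp add: p_def sum.distrib)
    also have "\<dots> \<le> 1" using xy st unfolding D_def by (auto intro: convex_bound_le)
    finally have "p (s *\<^sub>R x + t *\<^sub>R y) \<le> 1" .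
    moreover have "split (s *\<^sub>R x + t *\<^sub>R y) (\<lambda>f. s *\<^sub>R a f + t *\<^sub>R c f) (\<lambda>f. s *\<^sub>R b f + t *\<^sub>R d f)"
      unfolding split_def
    proof (intro conjI ballI)
      fix f assume f: "f \<in> F"
      show "s *\<^sub>R a f + t *\<^sub>R c f \<in> K" "s *\<^sub>R b f + t *\<^sub>R d f \<in> K"
        using ab cd f st unfolding split_def
        by (auto intro!: convex_cone_add[OF K] convex_cone_scaleR[OF K])
      have "x = a f + b f" "y = c f + d f" using ab cd f unfolding split_def by auto
      then show "s *\<^sub>R x + t *\<^sub>R y = s *\<^sub>R a f + t *\<^sub>R c f + (s *\<^sub>R b f + t *\<^sub>R d f)"
        by (simp add: algebra_simps)
    next
      have "(\<Sum>f\<in>F. dual_apply f (s *\<^sub>R a f + t *\<^sub>R c f) - dual_apply f (s *\<^sub>R b f + t *\<^sub>R d f)) =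
          (\<Sum>f\<in>F. s * (dual_apply f (a f) - dual_apply f (b f)) + t * (dual_apply f (c f) - dual_apply f (d f)))"
        by (intro sum.cong) (auto simp: algebra_simps)
      also have "\<dots> = s * (\<Sum>f\<in>F. dual_apply f (a f) - dual_apply f (b f)) +
          t * (\<Sum>f\<in>F. dual_apply f (c f) - dual_apply f (d f))"
        by (simp only: sum.distrib sum_distrib_left)
      also have "\<dots> = 1" using ab cd st(3) unfolding split_def by simp
      finally show "(\<Sum>f\<in>F. dual_apply f (s *\<^sub>R a f + t *\<^sub>R c f) - dual_apply f (s *\<^sub>R b f + t *\<^sub>R d f)) = 1" .
    qed
    ultimately show "s *\<^sub>R x + t *\<^sub>R y \<in> D" unfolding D_def by blast
  qed
  \<comment> \<open>Normality bounds each difference \<open>f (a f) - f (b f)\<close> by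
    \<open>2 * C * p x\<close>; these sum to 1, so \<open>p x\<close> is at least
    \<open>1 / (2 * C * (N + 1))\<close>. Cauchy-Schwarz passes to the sum of squares. Writing
    \<open>N + 1\<close> keeps the denominators positive for empty \<open>F\<close>.\<close>
  define m where "m = (1 / (2 * C * (N + 1)))\<^sup>2 / (N + 1)"
  have N: "N \<ge> 0" by (simp add: N_def)
  have m: "m > 0" using N \<open>C > 0\<close> by (auto simp: m_def intro!: divide_pos_pos zero_less_power mult_pos_pos add_nonneg_pos)
  obtain c where c: "\<And>x. x \<in> D \<Longrightarrow> m / 2 \<le> (\<Sum>f\<in>F. c f * dual_apply f x)"
  proof (rule separating_combination[OF linear_dual_apply \<open>convex D\<close> m])
    fix x assume x: "x \<in> D"
    then obtain a b where ab: "split x a b" unfolding D_def by blast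
    have "1 = (\<Sum>f\<in>F. dual_apply f (a f) - dual_apply f (b f))" using ab unfolding split_def by simp
    also have "\<dots> \<le> (\<Sum>f\<in>F. 2 * C * p x)"
    proof (rule sum_mono)
      fix f assume f: "f \<in> F"
      then have *: "a f \<in> K" "b f \<in> K" "x = a f + b f" using ab unfolding split_def by auto
      have "dual_apply f (a f) - dual_apply f (b f) \<le> p (a f) + p (b f)"
        using f_le_p[OF f, of "a f"] f_le_p[OF f, of "b f"] by linarith
      also have "\<dots> \<le> 2 * C * p x"
        using normal[OF *(1,2)] normal[OF *(2,1)] *(3) by (simp add: add.commute)
      finally show "dual_apply f (a f) - dual_apply f (b f) \<le> 2 * C * p x" .
    qed
    also have "\<dots> = N * (2 * C * p x)" by (simp add: N_def)
    also have "\<dots> \<le> (N + 1) * (2 * C * p x)" using \<open>C > 0\<close> p_nonneg by (intro mult_right_mono) auto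
    finally have "1 / (2 * C * (N + 1)) \<le> p x"
      using \<open>C > 0\<close> N by (subst pos_divide_le_eq) (auto simp: mult_ac intro: add_nonneg_pos)
    then have "(1 / (2 * C * (N + 1)))\<^sup>2 \<le> (p x)\<^sup>2" using \<open>C > 0\<close> N by (intro power_mono) auto
    also have "\<dots> \<le> N * (\<Sum>f\<in>F. (dual_apply f x)\<^sup>2)"
      using sum_squared_le_sum_of_squares[of "\<lambda>f. \<bar>dual_apply f x\<bar>" F] by (simp add: p_def N_def mult.commute)
    also have "\<dots> \<le> (N + 1) * (\<Sum>f\<in>F. (dual_apply f x)\<^sup>2)"
      by (intro mult_right_mono sum_nonneg) auto
    finally show "m \<le> (\<Sum>f\<in>F. (dual_apply f x)\<^sup>2)"
      using N by (simp add: m_def pos_divide_le_eq mult.commute)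
  next
    fix x assume "x \<in> D"
    then have "p x \<le> 1" by (simp add: D_def)
    have "(\<Sum>f\<in>F. (dual_apply f x)\<^sup>2) \<le> (\<Sum>f\<in>F. 1)"
    proof (rule sum_mono)
      fix f assume "f \<in> F"
      then have "\<bar>dual_apply f x\<bar> \<le> 1" using f_le_p[of f x] \<open>p x \<le> 1\<close> by linarith
      then show "(dual_apply f x)\<^sup>2 \<le> 1" by (simp add: abs_square_le_1)
    qed
    then show "(\<Sum>f\<in>F. (dual_apply f x)\<^sup>2) \<le> N" by (simp add: N_def)
  qed (use that in blast)
  define \<phi> where "\<phi> = (\<Sum>f\<in>F. c f *\<^sub>R f)"
  have \<phi>: "dual_apply \<phi> x = (\<Sum>f\<in>F. c f * dual_apply f x)" for x
    by (simp add: \<phi>_def dual_apply_sum)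
  have base: "k \<in> D" if k: "k \<in> K" "p k = 1" for k
  proof -
    let ?a = "\<lambda>f. if dual_apply f k \<ge> 0 then k else 0"
    let ?b = "\<lambda>f. if dual_apply f k \<ge> 0 then 0 else k"
    have "(\<Sum>f\<in>F. dual_apply f (?a f) - dual_apply f (?b f)) = p k"
      unfolding p_def by (intro sum.cong) auto
    then have "split k ?a ?b" using k convex_cone_contains_0[OF K] unfolding split_def by auto
    then show ?thesis using k unfolding D_def by auto
  qed
  have "m / 2 * p k \<le> dual_apply \<phi> k" if k: "k \<in> K" for k
  proof (cases "p k = 0")
    case True
    then have "dual_apply f k = 0" if "f \<in> F" for f using f_le_p[OF that, of k] by simp
    then show ?thesis using True by (simp add: \<phi>)
  next
    case False
    then have pk: "p k > 0" using p_nonneg[of k] by simp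
    have "inverse (p k) *\<^sub>R k \<in> D"
      using pk k by (intro base convex_cone_scaleR[OF K]) (auto simp: p_scale)
    from c[OF this, folded \<phi>] have "m / 2 \<le> inverse (p k) * dual_apply \<phi> k" by simp
    then show ?thesis using pk by (simp add: field_simps)
  qed
  then show thesis using that[of "m / 2" \<phi>] m by simp
qed

theorem theorem3p11:
  fixes K :: "'a::hausdorff_lcs set"
  assumes "infrabarreled TYPE('a)"
    and "convex_cone K"
    and "pointed K"
  shows "weak_property_pi K \<longleftrightarrow> zero_in_bPC K \<and> pointed (bidual_closure K)"
proof
  assume "weak_property_pi K"
  then show "zero_in_bPC K \<and> pointed (bidual_closure K)"
    using weak_property_pi_imp_zero_in_bPC weak_property_pi_imp_pointed_bidual_closure assms(2) by blast
next
  assume R: "zero_in_bPC K \<and> pointed (bidual_closure K)"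
  then obtain W where W: "weak_nbhd_0 W" "tvs_bounded (W \<inter> K)" unfolding zero_in_bPC_def by blast
  obtain F \<epsilon> where F: "finite F" "\<epsilon> > 0" "{x. (\<Sum>f\<in>F. \<bar>dual_apply f x\<bar>) < \<epsilon>} \<subseteq> W"
    using weak_nbhd_0_sum_abs[OF W(1)] .
  let ?p = "\<lambda>x. \<Sum>f\<in>F. \<bar>dual_apply f x\<bar>"
  have bdd: "tvs_bounded (K \<inter> {x. ?p x < \<epsilon>})"
    by (rule tvs_bounded_subset[OF W(2)]) (use F(3) in blast)
  obtain C where C: "C > 0" "\<And>a b. a \<in> K \<Longrightarrow> b \<in> K \<Longrightarrow> ?p a \<le> C * ?p (a + b)"
    using normal_of_pointed_bidual_closure[OF assms(1,2) F(1,2) bdd] R by blast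
  obtain \<phi> \<delta> where \<phi>: "\<delta> > 0" "\<And>k. k \<in> K \<Longrightarrow> \<delta> * ?p k \<le> dual_apply \<phi> k"
    using normal_imp_dominating_functional[OF assms(2) F(1) C] by blast
  have "\<phi> \<in> dual_cone K"
    unfolding dual_cone_def using \<phi> by (auto intro!: order_trans[OF _ \<phi>(2)] mult_nonneg_nonneg sum_nonneg)
  \<comment> \<open>Half of \<open>\<delta> * \<epsilon>\<close> is taken because the sublevel set
    of \<open>\<phi>\<close> is closed while the bounded set is given by the strict inequality
    \<open>p x < \<epsilon>\<close>.\<close>
  moreover have "tvs_bounded (K \<inter> {x. dual_apply \<phi> x \<le> \<delta> * \<epsilon> / 2})"
  proof (rule tvs_bounded_subset[OF bdd], safe)
    fix x assume x: "x \<in> K" "dual_apply \<phi> x \<le> \<delta> * \<epsilon> / 2"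
    have "\<delta> * ?p x \<le> \<delta> * (\<epsilon> / 2)" using \<phi>(2)[OF x(1)] x(2) by simp
    then show "?p x < \<epsilon>" using \<phi>(1) F(2) by simp
  qed
  ultimately show "weak_property_pi K"
    unfolding weak_property_pi_def using \<phi>(1) F(2) by (intro bexI[of _ \<phi>] exI[of _ "\<delta> * \<epsilon> / 2"]) auto
qed

end
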